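(* Let $s$ and $n$ be positive integers and let $f_0 \in \mathbf{F}_{2^s}[x]$ be an irreducible monic polynomial of degree $n$. Let $2^{l_s}$ be the greatest power of $2$ which divides $s$ and let $2^{l_n}$ be the greatest power of $2$ which divides $n$. Fix an element $\alpha \in \mathbf{F}_{2^s}^*$. Let $f_1 \in \mathbf{F}_{2^s}[x]$ be one of the (at most two) irreducible monic factors of $f_0^{(Q,\alpha)}$ in $\mathbf{F}_{2^s}[x]$, and suppose that the roots of $f_1$ are not $\theta_\alpha$-periodic. Consider any sequence of polynomials $\{f_i\}_{i \geq 0}$ in $\mathbf{F}_{2^s}[x]$ constructed inductively from $f_0$ and $f_1$ by setting $f_i$, for each $i \geq 2$, equal to one of the irreducible monic factors of $f_{i-1}^{(Q,\alpha)}$ in $\mathbf{F}_{2^s}[x]$. Then there exists a positive integer $t \leq l_s + l_n + 3$ such that $f_t$ has degree $2n$, while $f_{t+1}$ has degree $4n$. Moreover, for any $i \geq t$, the polynomial $f_i^{(Q,\alpha)}$ is irreducible in $\mathbf{F}_{2^s}[x]$ and the degree of $f_{i+1}$ is twice the degree of $f_i$.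
   Context: For a positive integer $m$, $\mathbf{F}_{2^m}$ denotes the field with $2^m$ elements. For $\alpha \in \mathbf{F}_{2^s}^*$ and a polynomial $f \in \mathbf{F}_{2^s}[x]$ of positive degree $d$, the $(Q,\alpha)$-transform of $f$ is the polynomial $f^{(Q,\alpha)}(x) = x^d \cdot f(x + \alpha x^{-1})$. For any positive integer $m$ and $\alpha \in \mathbf{F}_{2^m}^*$, the map $\theta_\alpha$ on $\mathbf{P}^1(\mathbf{F}_{2^m}) = \mathbf{F}_{2^m} \cup \{\infty\}$ is defined by $\theta_\alpha(x) = \infty$ if $x \in \{0, \infty\}$ and $\theta_\alpha(x) = x + \alpha x^{-1}$ otherwise. An element $\beta \in \mathbf{P}^1(\mathbf{F}_{2^m})$ is called $\theta_\alpha$-periodic if $\theta_\alpha^i(\beta) = \beta$ for some positive integer $i$, where $\theta_\alpha^i$ is the $i$-fold iterate of $\theta_\alpha$. For an element $\alpha \in \mathbf{F}_{2^s}^*$ and a root $\beta$ (of a polynomial over $\mathbf{F}_{2^s}$) lying in an extension $\mathbf{F}_{2^m}$ of $\mathbf{F}_{2^s}$, the element $\alpha$ is regarded as an element of $\mathbf{F}_{2^m}^*$; periodicity of $\beta$ does not depend on the chosen extension containing it. *)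

theory Defs
  imports "HOL-Algebra.Algebraic_Closure_Type" "HOL-Library.Cardinality"
begin

(* The (Q, a)-transform x^d * f (x + a / x), d = degree f, with the power x^d distributed over
   the terms of f. Q_transform_fract below is the defining identity in the field of rational
   functions, and it determines the transform because to_fract is injective. *)
definition Q_transform :: "'a::field \<Rightarrow> 'a poly \<Rightarrow> 'a poly" where
  "Q_transform a f =
     (\<Sum>i\<le>Polynomial.degree f. smult (Polynomial.coeff f i)
        ([:a, 0, 1:] ^ i * [:0, 1:] ^ (Polynomial.degree f - i)))"

lemma Q_transform_fract:
  fixes a :: "'a::field" and f :: "'a poly"
  defines "T \<equiv> to_fract [:0, 1:]" and "C \<equiv> (\<lambda>c. to_fract [:c:])"
  shows "to_fract (Q_transform a f) =
           T ^ Polynomial.degree f * poly (map_poly C f) (T + C a * inverse T)"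
proof -
  have T0: "T \<noteq> 0" by (simp add: T_def)
  have C0: "C 0 = 0" by (simp add: C_def)
  have Cinj: "C c = 0 \<longleftrightarrow> c = 0" for c by (simp add: C_def)
  have deg: "Polynomial.degree (map_poly C f) = Polynomial.degree f"
    by (rule degree_map_poly) (simp add: Cinj)
  have pw: "to_fract (p ^ k) = to_fract p ^ k" for p :: "'a poly" and k
    by (induction k) auto
  have sm: "to_fract (\<Sum>i\<in>A. g i) = (\<Sum>i\<in>A. to_fract (g i))"
    for g :: "nat \<Rightarrow> 'a poly" and A
    by (induction A rule: infinite_finite_induct) auto
  have q: "to_fract [:a, 0, 1:] = T * (T + C a * inverse T)"
  proof -
    have "[:a, 0, 1:] = [:0, 1:] * [:0, 1:] + [:a:]" by simp
    hence "to_fract [:a, 0, 1:] = T * T + C a"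
      unfolding T_def C_def by (metis to_fract_add to_fract_mult)
    thus ?thesis using T0 by (simp add: field_simps)
  qed
  have "to_fract (Q_transform a f) =
     (\<Sum>i\<le>Polynomial.degree f. C (Polynomial.coeff f i) *
        ((T * (T + C a * inverse T)) ^ i * T ^ (Polynomial.degree f - i)))"
  proof -
    have "smult c p = [:c:] * p" for c :: 'a and p by simp
    thus ?thesis
      unfolding Q_transform_def sm by (simp add: pw q T_def [symmetric] C_def del: mult_pCons_left)
  qed
  also have "\<dots> = (\<Sum>i\<le>Polynomial.degree f. T ^ Polynomial.degree f *
        (C (Polynomial.coeff f i) * (T + C a * inverse T) ^ i))"
  proof (rule sum.cong)
    fix i assume "i \<in> {..Polynomial.degree f}"
    hence "T ^ Polynomial.degree f = T ^ i * T ^ (Polynomial.degree f - i)"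
      by (simp flip: power_add)
    thus "C (Polynomial.coeff f i) *
        ((T * (T + C a * inverse T)) ^ i * T ^ (Polynomial.degree f - i)) =
        T ^ Polynomial.degree f * (C (Polynomial.coeff f i) * (T + C a * inverse T) ^ i)"
      by (simp add: power_mult_distrib)
  qed simp
  also have "\<dots> = T ^ Polynomial.degree f * poly (map_poly C f) (T + C a * inverse T)"
    by (simp add: poly_altdef deg coeff_map_poly C0 sum_distrib_left)
  finally show ?thesis .
qed

(* The projective line over the field 'a is modelled by 'a option, with None as the point at
   infinity. *)
fun theta :: "'a::field \<Rightarrow> 'a option \<Rightarrow> 'a option" where
  "theta a None = None"
| "theta a (Some x) = (if x = 0 then None else Some (x + a * inverse x))"

definition theta_periodic :: "'a::field \<Rightarrow> 'a option \<Rightarrow> bool" where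
  "theta_periodic a b \<longleftrightarrow> (\<exists>i>0. (theta a ^^ i) b = b)"

(* Over a finite field the algebraic closure is the union of all finite extensions, and theta
   on its projective line restricts to theta on the projective line of each of them. Roots
   are therefore taken in the closure, with a embedded by to_ac. *)
definition roots_not_periodic :: "'a::field \<Rightarrow> 'a poly \<Rightarrow> bool" where
  "roots_not_periodic a f \<longleftrightarrow>
     (\<forall>b :: 'a alg_closure. poly (map_poly to_ac f) b = 0 \<longrightarrow>
        \<not> theta_periodic (to_ac a) (Some b))"

definition irreducible_monic_factor :: "'a::field poly \<Rightarrow> 'a poly \<Rightarrow> bool" where
  "irreducible_monic_factor g h \<longleftrightarrow>
     Factorial_Ring.irreducible g \<and> lead_coeff g = 1 \<and> g dvd h"

end

theory Submission
  imports Defs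
begin

text \<open>
Let \<open>q = 2 ^ s\<close>. Every \<open>\<alpha>\<close> is a square \<open>g ^ 2\<close> in the field with \<open>q\<close> elements, and dividing roots by
\<open>g\<close> turns \<open>theta \<alpha>\<close> into \<open>th x = x + inverse x\<close>. A root of \<open>f (i + 1)\<close> is mapped by \<open>th\<close> to a
root of \<open>f i\<close>, so the sequence of polynomials is a backward orbit of \<open>th\<close>, and the degree of
\<open>f i\<close> tells which fields \<open>F_(q ^ k)\<close> contain the orbit at time \<open>i\<close> (\<open>root_in_subfield2_iff\<close>).

The equation \<open>th x = y\<close> is an Artin-Schreier equation: over \<open>F = F_(2 ^ m)\<close> it is solvable if and
only if \<open>1 / y\<close> has trace 0. If \<open>y\<close> and \<open>1 / y\<close> both have trace 1, then \<open>x\<close> generates the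
quadratic extension, where its conjugate is \<open>1 / x\<close>; hence \<open>x\<close> and \<open>1 / x\<close> have trace \<open>tr y = 1\<close>
there, and the situation repeats (\<open>th_preimage_doubles\<close>). Once a backward orbit enters this state,
its degree doubles at each step for ever.

Why it enters the state soon is a matter of elliptic curves. On x-coordinates, \<open>th\<close> is the
isogeny dual to Frobenius on the Koblitz curve \<open>y ^ 2 + x * y = x ^ 3 + 1\<close>, and the elements with
\<open>tr x = tr (1 / x)\<close> are the x-coordinates of its points over \<open>F\<close>. On this group the trace of the
x-coordinate is a homomorphism that vanishes on the image of \<open>th\<close>. The kernels of the iterates of \<open>th\<close>
form a tree above 1, whose level \<open>k\<close> lives in the field with \<open>2 ^ 2 ^ k\<close> elements
(\<open>tree_point\<close>, \<open>tree_depth\<close>); with \<open>e = multiplicity 2 m\<close>, the last level inside \<open>F\<close> is \<open>e\<close>, and it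
has trace 1. Translating by these points shows that all trees of non-periodic points over \<open>F\<close> have
at most the height of that one: \<open>th\<close> is injective on the image of the curve points under \<open>th ^^ (e + 2)\<close>, so that
this image consists of periodic points (\<open>th_iter_periodic\<close>). The group law itself is avoided: only the
relation \<open>\<plusminus>P \<plusminus> Q \<plusminus> R = 0\<close> between three x-coordinates is used (\<open>sum_rel\<close>), its invariance under \<open>th\<close>, and
a single chord construction (\<open>ex_sum\<close>).

For the conclusion take \<open>m = 2 * s * n\<close>, so that \<open>F\<close> is quadratic over the field of the roots of
\<open>f 0\<close>. Traces from \<open>F\<close> vanish on that smaller field, which puts the whole orbit on the curve for as
long as it stays in \<open>F\<close>. As the roots of \<open>f 1\<close> are not periodic, it leaves \<open>F\<close> after at most
\<open>multiplicity 2 m + 2\<close> steps, and at the last time \<open>t\<close> inside \<open>F\<close> both traces are 1 (\<open>backward_orbit_doubling\<close>).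
\<close>

section \<open>Preliminaries on natural numbers and iteration\<close>

lemma eq_double_of_dvd:
  fixes a b :: nat
  assumes "a dvd b" "b dvd 2 * a" "\<not> b dvd a"
  shows "b = 2 * a"
proof -
  obtain c where c: "b = a * c" using assms(1) by blast
  have "a \<noteq> 0" using assms(3) by (metis dvd_0_right)
  then have "c dvd 2" using assms(2) c by (simp add: mult.commute[of 2])
  then have "c = 1 \<or> c = 2" using dvd_imp_le[of c 2] by (auto simp: le_Suc_eq numeral_2_eq_2)
  then show ?thesis using assms(3) c by auto
qed

lemma odd_div_max_power:
  assumes "(M::nat) > 0"
  shows "odd (M div 2 ^ multiplicity 2 M)"
  using multiplicity_decompose[of M "2::nat"] assms by (simp)

lemma inj_self_map_periodic:
  assumes "finite N" "f ` N \<subseteq> N" "inj_on f N" "x \<in> N"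
  shows "\<exists>i>0. (f ^^ i) x = x"
proof -
  have N: "(f ^^ i) x \<in> N" for i
    using assms(2,4) by (induction i) auto
  then have "\<not> inj_on (\<lambda>i. (f ^^ i) x) UNIV"
    using assms(1) by (metis finite_imageD finite_subset image_subsetI infinite_UNIV_nat)
  then obtain i j where "i < j" "(f ^^ i) x = (f ^^ j) x"
    by (metis (mono_tags, lifting) inj_onI linorder_neqE_nat)
  moreover have "(f ^^ (i + (j - i))) x = (f ^^ i) ((f ^^ (j - i)) x)"
    by (simp add: funpow_add)
  ultimately have eq: "(f ^^ i) ((f ^^ (j - i)) x) = (f ^^ i) x"
    by simp
  have "inj_on (f ^^ i) N"
  proof (induction i)
    case (Suc i)
    have "(f ^^ i) ` N \<subseteq> N" using assms(2) by (induction i) auto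
    then show ?case unfolding funpow.simps
      by (intro comp_inj_on Suc inj_on_subset[OF assms(3)])
  qed simp
  then have "(f ^^ (j - i)) x = x" using eq N assms(4) by (metis inj_onD)
  then show ?thesis using \<open>i < j\<close> by (intro exI[of _ "j - i"]) simp
qed

section \<open>Finite subfields in characteristic two\<close>

text \<open>
The field with \<open>2 ^ m\<close> elements, as a subset of an algebraically closed field of characteristic two.
\<close>

definition subfield2 :: "nat \<Rightarrow> 'b::field set" where
  "subfield2 m = {x. x ^ (2 ^ m) = x}"

text \<open>
The simplification rules below remove all signs and cancel equal summands. A polynomial identity
that holds in characteristic two is then proved by expanding both sides into sums of monomials.
\<close>

locale closed_field_char2 =
  fixes F :: "'b::alg_closed_field itself"
  assumes char2: "CHAR('b) = 2"
begin

lemma two_zero [simp]: "(2::'b) = 0"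
proof -
  have "of_nat CHAR('b) = (0::'b)" by (rule of_nat_CHAR)
  then show ?thesis by (simp add: char2)
qed

lemma add_self [simp]: "(x::'b) + x = 0"
proof -
  have "x + x = 2 * x" by simp
  then show ?thesis by (simp only: two_zero mult_zero_left)
qed

lemma add_self_left [simp]: "(x::'b) + (x + y) = y"
  by (simp flip: add.assoc)

lemma minus_eq [simp]: "- (x::'b) = x"
  by (simp only: neg_eq_iff_add_eq_0 add_self)

lemma diff_eq [simp]: "(x::'b) - y = x + y"
  by (metis minus_eq uminus_add_conv_diff add.commute)

lemma add_eq_0 [simp]: "(x::'b) + y = 0 \<longleftrightarrow> x = y"
  by (metis add_self add_self_left add.right_neutral)

lemma pow_add: "((x::'b) + y) ^ (2 ^ m) = x ^ (2 ^ m) + y ^ (2 ^ m)"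
  by (rule freshmans_dream') (simp_all add: char2)

lemma square_add: "((x::'b) + y) ^ 2 = x ^ 2 + y ^ 2"
  using pow_add[of x y 1] by simp

lemma pow_sum: "(\<Sum>i\<in>I. (f i :: 'b)) ^ (2 ^ m) = (\<Sum>i\<in>I. f i ^ (2 ^ m))"
  by (rule freshmans_dream_sum') (simp_all add: char2)

lemma subfield2_add: "(x::'b) \<in> subfield2 m \<Longrightarrow> y \<in> subfield2 m \<Longrightarrow> x + y \<in> subfield2 m"
  by (simp add: subfield2_def pow_add)

lemma subfield2_mult: "(x::'b) \<in> subfield2 m \<Longrightarrow> y \<in> subfield2 m \<Longrightarrow> x * y \<in> subfield2 m"
  by (simp add: subfield2_def power_mult_distrib)

lemma subfield2_inverse: "(x::'b) \<in> subfield2 m \<Longrightarrow> inverse x \<in> subfield2 m"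
  by (simp add: subfield2_def power_inverse)

lemma subfield2_divide: "(x::'b) \<in> subfield2 m \<Longrightarrow> y \<in> subfield2 m \<Longrightarrow> x / y \<in> subfield2 m"
  by (simp add: subfield2_mult subfield2_inverse divide_inverse)

lemma subfield2_power: "(x::'b) \<in> subfield2 m \<Longrightarrow> x ^ k \<in> subfield2 m"
  by (simp add: subfield2_def flip: power_mult) (simp add: power_mult mult.commute[of k])

lemma subfield2_0_1 [simp]: "0 \<in> subfield2 m" "1 \<in> subfield2 m"
  by (simp_all add: subfield2_def)

lemma pow_iter: "(x::'b) \<in> subfield2 m \<Longrightarrow> x ^ (2 ^ (m * k)) = x"
  by (induction k) (simp_all add: power_add power_mult subfield2_def)

lemma subfield2_multiple: "(x::'b) \<in> subfield2 m \<Longrightarrow> x \<in> subfield2 (m * k)"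
  by (simp add: subfield2_def pow_iter)

lemma finite_subfield2:
  assumes "m > 0"
  shows "finite (subfield2 m :: 'b set)" and "card (subfield2 m :: 'b set) \<le> 2 ^ m"
proof -
  let ?p = "Polynomial.monom 1 (2 ^ m) - Polynomial.monom 1 1 :: 'b poly"
  have m: "(1::nat) < 2 ^ m"
    using assms by (intro one_less_power) simp_all
  then have "Polynomial.coeff ?p 1 \<noteq> 0"
    using assms by (simp add: Polynomial.coeff_monom)
  then have p: "?p \<noteq> 0"
    by (metis Polynomial.coeff_0)
  have eq: "{x. poly ?p x = 0} = subfield2 m"
    by (simp add: subfield2_def poly_monom)
  show "finite (subfield2 m :: 'b set)"
    using poly_roots_finite[OF p] by (simp only: eq)
  have "card {x. poly ?p x = 0} \<le> Polynomial.degree ?p"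
    using p by (rule card_poly_roots_bound)
  also have "\<dots> \<le> 2 ^ m"
    using m by (intro degree_diff_le) (simp_all add: degree_monom_le Polynomial.degree_monom_eq)
  finally show "card (subfield2 m :: 'b set) \<le> 2 ^ m"
    by (simp only: eq)
qed

end

section \<open>Trace and Artin-Schreier equations\<close>

text \<open>
On \<open>subfield2 m\<close> this is the absolute trace, with values in the prime field \<open>{0, 1}\<close>.
\<close>

definition tr :: "nat \<Rightarrow> 'b::field \<Rightarrow> 'b" where
  "tr m x = (\<Sum>i<m. x ^ (2 ^ i))"

context closed_field_char2
begin

lemma tr_add: "tr m ((x::'b) + y) = tr m x + tr m y"
  by (simp add: tr_def pow_add sum.distrib)

lemma tr_0 [simp]: "tr m (0::'b) = 0"
  by (simp add: tr_def power_0_left)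

lemma tr_pow: "tr m ((x::'b) ^ (2 ^ k)) = tr m x ^ (2 ^ k)"
  by (simp add: tr_def pow_sum mult.commute flip: power_mult)

lemma tr_pow_telescope: "tr m ((z::'b) ^ 2 + z) = z ^ (2 ^ m) + z"
proof (induction m)
  case (Suc m)
  have "tr (Suc m) (z ^ 2 + z) = z ^ (2 ^ m) + z + (z ^ 2 + z) ^ (2 ^ m)"
    using Suc by (simp add: tr_def)
  also have "\<dots> = z ^ (2 ^ Suc m) + z"
    by (simp add: pow_add add_ac flip: power_mult)
  finally show ?case .
qed (simp add: tr_def)

lemma ex_artin_schreier: "\<exists>z::'b. z ^ 2 + z = c"
proof -
  have "\<exists>z. poly [:c, 1, 1:] z = 0"
    by (rule alg_closed_imp_poly_has_root) simp
  then obtain z where "poly [:c, 1, 1:] z = 0" ..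
  then have "c + (z ^ 2 + z) = 0"
    by (simp add: power2_eq_square algebra_simps)
  then show ?thesis
    by auto
qed

text \<open>
Additive Hilbert 90. The closure contains a solution \<open>z\<close> of \<open>z ^ 2 + z = x\<close>, and the trace of \<open>x\<close>
telescopes to \<open>z ^ (2 ^ m) + z\<close>, which vanishes exactly when \<open>z\<close> lies in the subfield.
\<close>

lemma tr_eq_0_iff:
  assumes "(x::'b) \<in> subfield2 m"
  shows "tr m x = 0 \<longleftrightarrow> (\<exists>z\<in>subfield2 m. z ^ 2 + z = x)"
proof -
  obtain z where z: "z ^ 2 + z = x"
    using ex_artin_schreier by blast
  then have "tr m x = 0 \<longleftrightarrow> z \<in> subfield2 m"
    using tr_pow_telescope[of m z] by (simp add: subfield2_def)
  moreover have "tr m x = 0" if "w \<in> subfield2 m" "w ^ 2 + w = x" for w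
    using that tr_pow_telescope[of m w] by (simp add: subfield2_def)
  ultimately show ?thesis
    using z by blast
qed

lemma tr_0_or_1:
  assumes "(x::'b) \<in> subfield2 m"
  shows "tr m x = 0 \<or> tr m x = 1"
proof -
  have "tr m x ^ 2 + tr m x = tr m (x ^ 2 + x)"
    using tr_pow[of m x 1] by (simp add: tr_add)
  also have "\<dots> = 0"
    using assms tr_pow_telescope[of m x] by (simp add: subfield2_def)
  finally have "tr m x * (tr m x + 1) = 0"
    by (simp add: power2_eq_square algebra_simps)
  then show ?thesis
    by auto
qed

lemma tr_square:
  assumes "(x::'b) \<in> subfield2 m"
  shows "tr m (x ^ 2) = tr m x"
  using tr_pow[of m x 1] tr_0_or_1[OF assms] by auto

lemma tr_split: "tr (m + k) (x::'b) = tr m x + tr k (x ^ (2 ^ m))"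
  by (induction k) (simp_all add: tr_def power_add add_ac mult.commute flip: power_mult)

lemma tr_double: "tr (2 * m) (x::'b) = tr m (x + x ^ (2 ^ m))"
  by (simp add: mult_2 tr_split tr_add)

lemma tr_multiple:
  assumes "(x::'b) \<in> subfield2 m"
  shows "tr (m * k) x = of_nat k * tr m x"
proof (induction k)
  case (Suc k)
  then show ?case
    using pow_iter[OF assms, of k] tr_split[of "m * k" m x] by (simp add: algebra_simps)
qed (simp add: tr_def)

lemma of_nat_parity: "(of_nat k :: 'b) = (if even k then 0 else 1)"
proof (cases "even k")
  case True
  then show ?thesis by (auto simp: two_zero elim!: evenE)
next
  case False
  then show ?thesis by (auto simp: two_zero elim!: oddE)
qed

end

section \<open>Preimages under the map x + 1 / x\<close>

text \<open>
Since \<open>inverse 0 = 0\<close>, this total map sends 0 to 0: the points 0 and infinity of the projective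
line are merged into one fixed point. Away from the backward orbit of 0 it is \<open>theta 1\<close>.
\<close>

definition th :: "'b::field \<Rightarrow> 'b" where
  "th x = x + inverse x"

context closed_field_char2
begin

lemma subfield2_th: "(x::'b) \<in> subfield2 m \<Longrightarrow> th x \<in> subfield2 m"
  by (simp add: th_def subfield2_add subfield2_inverse)

lemma subfield2_th_iter: "(x::'b) \<in> subfield2 m \<Longrightarrow> (th ^^ k) x \<in> subfield2 m"
  by (induction k) (simp_all add: subfield2_th)

lemma th_0_1 [simp]: "th (0::'b) = 0" "th (1::'b) = 0"
  by (simp_all add: th_def)

lemma th_quadratic: "(x::'b) \<noteq> 0 \<Longrightarrow> x ^ 2 + th x * x = 1"
  by (simp add: th_def algebra_simps power2_eq_square)

lemma th_eq_iff:
  assumes "(x::'b) \<noteq> 0" "y \<noteq> 0"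
  shows "th x = th y \<longleftrightarrow> x = y \<or> x * y = 1"
proof -
  have "(th x + th y) * (x * y) = (x + y) * (x * y + 1)"
    using assms by (simp add: th_def algebra_simps)
  then have "th x + th y = 0 \<longleftrightarrow> x + y = 0 \<or> x * y + 1 = 0"
    using assms by (metis mult_eq_0_iff)
  then show ?thesis by simp
qed

lemma th_eq_0_iff: "th (x::'b) = 0 \<longleftrightarrow> x = 0 \<or> x = 1"
proof (cases "x = 0")
  case False
  have "(x + 1) ^ 2 = x * th x"
    using False by (simp add: square_add) (simp add: th_def power2_eq_square algebra_simps)
  then show ?thesis using False
    by (metis add_eq_0 mult_eq_0_iff power2_eq_square power_zero_numeral)
qed simp

text \<open>
The element \<open>z = 1 / (x + 1)\<close> solves \<open>z ^ 2 + z = 1 / th x\<close>.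
\<close>

lemma tr_inverse_th:
  assumes "(x::'b) \<in> subfield2 m"
  shows "tr m (inverse (th x)) = 0"
proof (cases "th x = 0")
  case False
  then have x: "x \<noteq> 0" "x + 1 \<noteq> 0" by (auto simp: th_eq_0_iff)
  define z where "z = inverse (x + 1)"
  have z1: "z * (x + 1) = 1" using x by (simp add: z_def)
  have "z ^ 2 + z = inverse (th x)"
  proof -
    have "(x + 1) ^ 2 = x * th x"
      using x by (simp add: square_add) (simp add: th_def power2_eq_square algebra_simps)
    moreover have "(z ^ 2 + z) * (x + 1) ^ 2 = (z * (x + 1)) ^ 2 + (z * (x + 1)) * (x + 1)"
      by (simp add: algebra_simps power2_eq_square)
    ultimately have "(z ^ 2 + z) * (x * th x) = x"
      by (simp add: z1)
    then have "(z ^ 2 + z) * th x = 1" using x by (simp add: mult.left_commute)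
    then show ?thesis by (metis inverse_unique mult.commute)
  qed
  moreover have "z \<in> subfield2 m"
    using assms by (simp add: z_def subfield2_add subfield2_inverse)
  ultimately show ?thesis
    using assms by (auto simp: tr_eq_0_iff subfield2_inverse subfield2_th)
qed simp

text \<open>
Substituting \<open>x = th x * u\<close> into the quadratic equation of \<open>x\<close> gives \<open>u ^ 2 + u = (1 / th x) ^ 2\<close>.
\<close>

lemma th_preimage_in_subfield:
  assumes "th (x::'b) \<in> subfield2 m" "tr m (inverse (th x)) = 0"
  shows "x \<in> subfield2 m"
proof (cases "th x = 0")
  case True
  then show ?thesis by (auto simp: th_eq_0_iff)
next
  case False
  then have x: "x \<noteq> 0" by auto
  define u where "u = x / th x"
  have "u ^ 2 + u = (x ^ 2 + th x * x) / th x ^ 2"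
    using False by (simp add: u_def power2_eq_square field_simps)
  also have "\<dots> = inverse (th x) ^ 2"
    using x by (simp add: th_quadratic power_inverse divide_inverse)
  finally have "tr m (u ^ 2 + u) = 0"
    using assms by (simp add: tr_square subfield2_inverse)
  then have "u \<in> subfield2 m"
    by (simp add: tr_pow_telescope subfield2_def)
  moreover have "x = u * th x"
    using False by (simp add: u_def)
  ultimately show ?thesis
    using assms subfield2_mult by metis
qed

lemma th_pow: "th ((x::'b) ^ (2 ^ m)) = th x ^ (2 ^ m)"
  by (simp add: th_def pow_add power_inverse)

lemma th_conjugate:
  assumes "th (x::'b) \<in> subfield2 m" "x \<notin> subfield2 m"
  shows "x ^ (2 ^ m) = inverse x"
proof -
  have "th (x ^ (2 ^ m)) = th x"
    using assms(1) by (simp add: th_pow subfield2_def)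
  moreover have "x \<noteq> 0" using assms(2) by auto
  ultimately have "x ^ (2 ^ m) * x = 1"
    using th_eq_iff[of "x ^ (2 ^ m)" x] assms(2) by (auto simp: subfield2_def)
  then show ?thesis by (metis inverse_unique mult.commute)
qed

lemma th_preimage_quadratic:
  assumes "th (x::'b) \<in> subfield2 m"
  shows "x \<in> subfield2 (2 * m)"
proof (cases "x \<in> subfield2 m")
  case True
  then show ?thesis using subfield2_multiple[of x m 2] by (simp add: mult.commute)
next
  case False
  then have "x ^ (2 ^ m) = inverse x" using th_conjugate assms by blast
  then have "x ^ (2 ^ (m + m)) = x"
    by (simp add: power_add power_mult power_inverse)
  then show ?thesis by (simp add: subfield2_def mult_2)
qed

text \<open>
The conjugate of \<open>x\<close> over the smaller field is \<open>inverse x\<close>, so the relative trace of both \<open>x\<close> and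
\<open>inverse x\<close> is \<open>th x\<close>. The conclusions are the hypotheses for \<open>x\<close> over the quadratic extension.
\<close>

lemma th_preimage_doubles:
  assumes y: "th (x::'b) \<in> subfield2 m" and "tr m (th x) = 1" "tr m (inverse (th x)) = 1"
  shows "x \<notin> subfield2 m" "x \<in> subfield2 (2 * m)" "tr (2 * m) x = 1" "tr (2 * m) (inverse x) = 1"
proof -
  show n: "x \<notin> subfield2 m"
    using tr_inverse_th[of x m] assms(3) by auto
  show "x \<in> subfield2 (2 * m)"
    using th_preimage_quadratic[OF y] .
  have "x ^ (2 ^ m) = inverse x" by (rule th_conjugate[OF y n])
  then show "tr (2 * m) x = 1" "tr (2 * m) (inverse x) = 1"
    using assms(2) by (simp_all add: tr_double power_inverse th_def add.commute)
qed

text \<open>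
Repeated doubling, starting from \<open>1\<close> in the field with two elements.
\<close>

lemma tree_point:
  assumes "(th ^^ k) (x::'b) = 1"
  shows "x \<in> subfield2 (2 ^ k) \<and> tr (2 ^ k) x = 1 \<and> tr (2 ^ k) (inverse x) = 1"
  using assms
proof (induction k arbitrary: x)
  case 0
  then show ?case by (simp add: tr_def)
next
  case (Suc k)
  then have "(th ^^ k) (th x) = 1" by (simp add: funpow_swap1)
  from Suc.IH[OF this] show ?case using th_preimage_doubles[of x "2 ^ k"] by auto
qed

lemma tree_point_tr:
  assumes "(th ^^ k) (x::'b) = 1" "2 ^ k dvd M"
  shows "x \<in> subfield2 M" "tr M x = of_nat (M div 2 ^ k)" "tr M (inverse x) = of_nat (M div 2 ^ k)"
proof -
  obtain c where c: "M = 2 ^ k * c" using assms(2) by blast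
  have x: "x \<in> subfield2 (2 ^ k)" "tr (2 ^ k) x = 1" "tr (2 ^ k) (inverse x) = 1"
    using tree_point[OF assms(1)] by auto
  then show "x \<in> subfield2 M" "tr M x = of_nat (M div 2 ^ k)" "tr M (inverse x) = of_nat (M div 2 ^ k)"
    by (simp_all add: c subfield2_multiple tr_multiple subfield2_inverse)
qed

text \<open>
A deeper \<open>x\<close> would have an iterate \<open>w\<close> over the field such that \<open>th w\<close> is at level
\<open>multiplicity 2 M\<close>. Then \<open>inverse (th w)\<close> has as trace an odd multiple of 1, against \<open>tr_inverse_th\<close>.
\<close>

lemma tree_depth:
  assumes "M > 0" "(x::'b) \<in> subfield2 M" "(th ^^ k) x = 1"
  shows "k \<le> multiplicity 2 M"
proof (rule ccontr)
  let ?e = "multiplicity 2 M"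
  assume "\<not> k \<le> ?e"
  then have k: "k = Suc ?e + (k - Suc ?e)" by simp
  define w where "w = (th ^^ (k - Suc ?e)) x"
  have w: "w \<in> subfield2 M"
    using assms by (simp add: w_def subfield2_th_iter)
  have "(th ^^ Suc ?e) w = 1"
    using assms(3) k by (metis w_def comp_apply funpow_add)
  then have "(th ^^ ?e) (th w) = 1"
    by (simp add: funpow_swap1)
  from tree_point_tr(3)[OF this, of M] have "tr M (inverse (th w)) = 1"
    using odd_div_max_power[OF assms(1)] by (simp add: multiplicity_dvd of_nat_parity)
  then show False using tr_inverse_th[OF w] by simp
qed

end

section \<open>Translation on the Koblitz curve\<close>

text \<open>
Three nonzero elements satisfy this relation exactly when they are the x-coordinates of points on the
curve \<open>y ^ 2 + x * y = x ^ 3 + 1\<close> with \<open>\<plusminus>P \<plusminus> Q \<plusminus> R = 0\<close> for some choice of signs.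
\<close>

definition sum_rel :: "'b::field \<Rightarrow> 'b \<Rightarrow> 'b \<Rightarrow> bool" where
  "sum_rel a b c \<longleftrightarrow> (a * b + b * c + c * a) ^ 2 + a * b * c + 1 = 0"

text \<open>
The x-coordinates of rational points of the curve that no iterate of \<open>th\<close> sends to 0. For these,
infinity and the point \<open>0\<close> of order two never interfere.
\<close>

definition free_points :: "nat \<Rightarrow> 'b::field set" where
  "free_points m = {x \<in> subfield2 m. tr m x = tr m (inverse x) \<and> (\<forall>j. (th ^^ j) x \<noteq> 0)}"

context closed_field_char2
begin

text \<open>
The pullback of the relation along \<open>th\<close> says that the three points sum to a point in the kernel of
the isogeny, which has order two. It is therefore the product of the relation itself and of its
translate by the point of order two, that is, with \<open>inverse a\<close> in place of \<open>a\<close>.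
\<close>

lemma sum_rel_th:
  assumes "sum_rel (a::'b) b c" "a \<noteq> 0" "b \<noteq> 0" "c \<noteq> 0"
  shows "sum_rel (th a) (th b) (th c)"
proof -
  define A B C where "A = a * a + 1" and "B = b * b + 1" and "C = c * c + 1"
  have th: "th a = A / a" "th b = B / b" "th c = C / c"
    using assms by (simp_all add: A_def B_def C_def th_def field_simps)
  have "(A * B * c + B * C * a + C * A * b) ^ 2 + A * B * C * (a * b * c) + (a * b * c) ^ 2
    = ((a * b + b * c + c * a) ^ 2 + a * b * c + 1) * ((b + a * b * c + c) ^ 2 + a * b * c + a ^ 2)"
    unfolding A_def B_def C_def by (simp add: square_add algebra_simps power2_eq_square)
  \<comment> \<open>the first factor is the relation between \<open>a\<close>, \<open>b\<close> and \<open>c\<close>\<close>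
  also have "\<dots> = 0"
    using assms(1) by (simp add: sum_rel_def)
  finally have 0: "(A * B * c + B * C * a + C * A * b) ^ 2 + A * B * C * (a * b * c) + (a * b * c) ^ 2 = 0" .
  have "(th a * th b + th b * th c + th c * th a) ^ 2 + th a * th b * th c + 1
    = ((A * B * c + B * C * a + C * A * b) ^ 2 + A * B * C * (a * b * c) + (a * b * c) ^ 2) / (a * b * c) ^ 2"
    using assms(2-4) unfolding th by (simp add: field_simps power2_eq_square)
  then show ?thesis by (simp only: 0 sum_rel_def) simp
qed

text \<open>
With \<open>y = x * z\<close> the equation of the curve becomes \<open>z ^ 2 + z = x + (1 / x) ^ 2\<close>, whose right-hand
side has trace 0, since squaring does not change the trace.
\<close>

lemma ex_curve_point:
  assumes "(x::'b) \<in> subfield2 m" "x \<noteq> 0" "tr m x = tr m (inverse x)"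
  shows "\<exists>y\<in>subfield2 m. y ^ 2 + x * y = x ^ 3 + 1"
proof -
  have "tr m (x + inverse x ^ 2) = 0"
    using assms by (simp add: tr_add tr_square subfield2_inverse)
  then obtain z where z: "z \<in> subfield2 m" "z ^ 2 + z = x + inverse x ^ 2"
    using assms by (auto simp: tr_eq_0_iff subfield2_add subfield2_inverse subfield2_power)
  have "(x * z) ^ 2 + x * (x * z) = x ^ 2 * (z ^ 2 + z)"
    by (simp add: power2_eq_square algebra_simps)
  also have "\<dots> = x ^ 3 + (x * inverse x) ^ 2"
    by (simp only: z(2)) (simp add: algebra_simps power2_eq_square power3_eq_cube)
  also have "\<dots> = x ^ 3 + 1"
    using assms(2) by simp
  finally show ?thesis using z(1) assms(1) subfield2_mult by blast
qed

lemma tr_of_curve_point: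
  assumes "(x::'b) \<in> subfield2 m" "y \<in> subfield2 m" "y ^ 2 + x * y = x ^ 3 + 1"
  shows "tr m x = tr m (inverse x)"
proof (cases "x = 0")
  case False
  have "(y / x) ^ 2 + y / x = (y ^ 2 + x * y) / x ^ 2"
    using False by (simp add: field_simps power2_eq_square)
  also have "\<dots> = x + inverse x ^ 2"
  proof -
    have "x ^ 3 / x ^ 2 = x"
      using False by (simp add: power2_eq_square power3_eq_cube)
    then show ?thesis
      by (simp add: assms(3) add_divide_distrib inverse_eq_divide power_one_over)
  qed
  finally have "tr m (x + inverse x ^ 2) = 0"
    using assms by (subst tr_eq_0_iff)
      (auto simp: subfield2_add subfield2_inverse subfield2_power intro!: bexI[of _ "y / x"] subfield2_divide)
  then show ?thesis
    using assms by (simp add: tr_add tr_square subfield2_inverse)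
qed simp

text \<open>
The chord through the two points has a third intersection with the curve, with x-coordinate
\<open>v = l ^ 2 + l + w + t\<close> for a rational slope \<open>l\<close>. As \<open>l ^ 2 + l\<close> has trace 0, the trace is additive.
\<close>

lemma ex_sum:
  assumes w: "(w::'b) \<in> subfield2 m" "w \<noteq> 0" "tr m w = tr m (inverse w)"
    and t: "t \<in> subfield2 m" "t \<noteq> 0" "tr m t = tr m (inverse t)"
    and "w \<noteq> t"
  shows "\<exists>v\<in>subfield2 m. sum_rel w t v \<and> tr m v = tr m w + tr m t \<and> tr m v = tr m (inverse v)"
proof -
  obtain y where y: "y \<in> subfield2 m" "y ^ 2 + w * y = w ^ 3 + 1"
    using ex_curve_point[OF w] by blast
  obtain s where s: "s \<in> subfield2 m" "s ^ 2 + t * s = t ^ 3 + 1"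
    using ex_curve_point[OF t] by blast
  \<comment> \<open>the chord is \<open>Y = l * X + u\<close>\<close>
  define l where "l = (y + s) / (w + t)"
  define u where "u = y + l * w"
  define v where "v = l ^ 2 + l + (w + t)"
  have l: "l \<in> subfield2 m" unfolding l_def by (intro subfield2_divide subfield2_add w t y s)
  have v: "v \<in> subfield2 m" unfolding v_def by (intro subfield2_power subfield2_add w t l)
  have u: "u \<in> subfield2 m" unfolding u_def by (intro subfield2_mult subfield2_add w y l)
  have ll: "l ^ 2 + l = w + t + v" by (simp add: v_def add_ac)
  have yl: "y = l * w + u" by (simp add: u_def add_ac)
  have "l * (w + t) = y + s" using \<open>w \<noteq> t\<close> by (simp add: l_def)
  then have sl: "s = l * t + u"
    by (metis add_self_left yl add.assoc add.commute distrib_left)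
  \<comment> \<open>the point with abscissa \<open>x\<close> lies on both the chord and the curve\<close>
  have cubic: "(t' + v) * x ^ 2 + u * x = u ^ 2 + 1"
    if "l ^ 2 + l = x + t' + v" "(l * x + u) ^ 2 + x * (l * x + u) = x ^ 3 + 1" for x t'
  proof -
    have "(l * x + u) ^ 2 + x * (l * x + u) = (l ^ 2 + l) * x ^ 2 + u * x + u ^ 2"
      by (simp add: power2_eq_square algebra_simps)
    then have "(x + t' + v) * x ^ 2 + u * x + u ^ 2 + (x ^ 3 + 1) = 0"
      using that by simp
    then have "(t' + v) * x ^ 2 + u * x + (u ^ 2 + 1) = 0"
      by (simp add: power2_eq_square power3_eq_cube algebra_simps)
    then show ?thesis by (simp only: add_eq_0)
  qed
  have cw: "(t + v) * w ^ 2 + u * w = u ^ 2 + 1"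
    using cubic[of w t] ll y(2) yl by simp
  have ct: "(w + v) * t ^ 2 + u * t = u ^ 2 + 1"
    using cubic[of t w] ll s(2) sl by (simp add: add_ac)
  \<comment> \<open>comparing \<open>cw\<close> and \<open>ct\<close> identifies \<open>u\<close> as the second elementary symmetric function of the abscissas\<close>
  have "(w + t) * (w * t + v * w + v * t + u) = ((t + v) * w ^ 2 + u * w) + ((w + v) * t ^ 2 + u * t)"
    by (simp add: power2_eq_square algebra_simps)
  also have "\<dots> = 0" by (simp only: cw ct add_self)
  finally have ue: "u = w * t + v * w + v * t"
    using \<open>w \<noteq> t\<close> by (metis add_eq_0 mult_eq_0_iff)
  have "w * t * v = (t + v) * w ^ 2 + u * w"
    unfolding ue by (simp add: power2_eq_square algebra_simps)
  then have wtv: "w * t * v = u ^ 2 + 1" using cw by simp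
  then have "sum_rel w t v"
    by (simp add: sum_rel_def ue mult.commute[of _ v] add_ac)
  moreover have "tr m v = tr m w + tr m t"
    using tr_pow_telescope[of m l] l by (simp add: v_def tr_add subfield2_def)
  moreover have "tr m v = tr m (inverse v)"
  proof (rule tr_of_curve_point[OF v])
    show "l * v + u + v \<in> subfield2 m" by (intro subfield2_add subfield2_mult l v u)
    have "(l * v + u + v) ^ 2 + v * (l * v + u + v) = (l ^ 2 + l) * v ^ 2 + u * v + u ^ 2"
      by (simp add: power2_eq_square algebra_simps)
    also have "\<dots> = v ^ 3 + w * t * v + u ^ 2"
      unfolding ll by (subst ue) (simp add: power2_eq_square power3_eq_cube algebra_simps)
    also have "\<dots> = v ^ 3 + 1" using wtv by (simp add: add_ac)
    finally show "(l * v + u + v) ^ 2 + v * (l * v + u + v) = v ^ 3 + 1" .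
  qed
  ultimately show ?thesis using v by blast
qed

lemma th_iter_0 [simp]: "(th ^^ j) (0::'b) = 0"
  by (induction j) simp_all

lemma th_iter_add: "(th ^^ (i + j)) (x::'b) = (th ^^ i) ((th ^^ j) x)"
  by (simp add: funpow_add)

lemma free_points_th:
  assumes "(x::'b) \<in> free_points m"
  shows "th x \<in> free_points m" "tr m (th x) = 0"
proof -
  have x: "x \<in> subfield2 m" "tr m x = tr m (inverse x)" "(th ^^ j) x \<noteq> 0" for j
    using assms by (auto simp: free_points_def)
  show tr0: "tr m (th x) = 0"
    using x(2) by (simp add: th_def tr_add)
  have "(th ^^ j) (th x) \<noteq> 0" for j
    using x(3)[of "Suc j"] by (simp add: funpow_swap1)
  then show "th x \<in> free_points m"
    using x(1) tr0 by (simp add: free_points_def subfield2_th tr_inverse_th)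
qed

text \<open>
Here \<open>v\<close> is the x-coordinate of the sum of the points with x-coordinates \<open>w\<close> and \<open>t\<close>. The iterate
\<open>th ^^ Suc j\<close> sends \<open>t\<close> to the point \<open>0\<close> of order two, and translation by that point is the map
\<open>x \<mapsto> inverse x\<close>. Thus \<open>v\<close> moves from \<open>(th ^^ Suc j) w\<close> to the other element with the same image
under \<open>th\<close>, at a known price in the trace.
\<close>

lemma translate:
  assumes w: "(w::'b) \<in> free_points m" and t: "(th ^^ j) (t::'b) = 1" "2 ^ j dvd m"
  shows "\<exists>v\<in>free_points m. tr m v = tr m w + of_nat (m div 2 ^ j) \<and>
           (th ^^ Suc j) v * (th ^^ Suc j) w = 1"
proof -
  have wf: "w \<in> subfield2 m" "tr m w = tr m (inverse w)" and w0: "(th ^^ i) w \<noteq> 0" for i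
    using w by (auto simp: free_points_def)
  have tS: "(th ^^ Suc j) t = 0" using t(1) by simp
  have t0: "(th ^^ i) t \<noteq> 0" if "i \<le> j" for i
  proof
    assume "(th ^^ i) t = 0"
    then have "(th ^^ (j - i + i)) t = 0" unfolding th_iter_add by simp
    then show False using that t(1) by simp
  qed
  have t0': "(th ^^ i) t = 0" if "i > j" for i
  proof -
    have "(th ^^ (i - Suc j + Suc j)) t = 0" unfolding th_iter_add tS by simp
    then show ?thesis using that by simp
  qed
  have "w \<noteq> t" using w0[of "Suc j"] tS by auto
  then obtain v where v: "v \<in> subfield2 m" "sum_rel w t v"
      "tr m v = tr m w + tr m t" "tr m v = tr m (inverse v)"
    using ex_sum[of w m t] wf w0[of 0] t0[of 0] tree_point_tr[OF t] by auto
  \<comment> \<open>if \<open>v\<close> reached 0, then the iterates of \<open>w\<close> and \<open>t\<close> would be inverse to each other, and \<open>w\<close> would end in 0 as \<open>t\<close> does\<close>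
  have ne: "(th ^^ i) v \<noteq> 0" if "sum_rel ((th ^^ i) w) ((th ^^ i) t) ((th ^^ i) v)" for i
  proof
    assume "(th ^^ i) v = 0"
    then have "((th ^^ i) w * (th ^^ i) t) ^ 2 = 1"
      using that by (simp add: sum_rel_def)
    then have "((th ^^ i) w * (th ^^ i) t + 1) ^ 2 = 0"
      by (simp add: square_add)
    then have 1: "(th ^^ i) w * (th ^^ i) t = 1" by simp
    then have "(th ^^ i) t \<noteq> 0" by auto
    then have "th ((th ^^ i) w) = th ((th ^^ i) t)"
      using w0 1 by (simp add: th_eq_iff)
    then have "(th ^^ Suc i) w = (th ^^ Suc i) t" by simp
    then have "(th ^^ (j + Suc i)) w = (th ^^ (j + Suc i)) t"
      unfolding th_iter_add by simp
    moreover have "(th ^^ (j + Suc i)) t = 0" by (rule t0') simp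
    ultimately show False using w0 by metis
  qed
  have rel: "sum_rel ((th ^^ i) w) ((th ^^ i) t) ((th ^^ i) v)" if "i \<le> Suc j" for i
    using that
  proof (induction i)
    case 0
    then show ?case using v by simp
  next
    case (Suc i)
    then have "sum_rel ((th ^^ i) w) ((th ^^ i) t) ((th ^^ i) v)" by simp
    from sum_rel_th[OF this w0 t0 ne[OF this]] show ?case using Suc by simp
  qed
  have "((th ^^ Suc j) w * (th ^^ Suc j) v) ^ 2 = 1"
    using rel[of "Suc j"] tS by (simp add: sum_rel_def mult.commute)
  then have "((th ^^ Suc j) w * (th ^^ Suc j) v + 1) ^ 2 = 0"
    by (simp add: square_add)
  then have inv: "(th ^^ Suc j) v * (th ^^ Suc j) w = 1"
    by (simp add: mult.commute)
  \<comment> \<open>from here on the orbits of \<open>v\<close> and \<open>w\<close> coincide, so that \<open>v\<close> never reaches 0\<close>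
  have S: "(th ^^ Suc (Suc j)) v = (th ^^ Suc (Suc j)) w"
  proof -
    have "(th ^^ Suc j) v \<noteq> 0" using inv by (metis mult_zero_left zero_neq_one)
    then have "th ((th ^^ Suc j) v) = th ((th ^^ Suc j) w)"
      by (rule th_eq_iff[THEN iffD2, OF _ w0 disjI2[OF inv]])
    then show ?thesis by simp
  qed
  have "(th ^^ i) v \<noteq> 0" for i
  proof
    assume "(th ^^ i) v = 0"
    then have "(th ^^ (Suc (Suc j) + i)) v = 0" unfolding th_iter_add by simp
    then have "(th ^^ (i + Suc (Suc j))) v = 0" by (simp only: add.commute)
    then have "(th ^^ (i + Suc (Suc j))) w = 0" unfolding th_iter_add S .
    then show False using w0 by blast
  qed
  then have "v \<in> free_points m" using v by (simp add: free_points_def)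
  then show ?thesis using inv v tree_point_tr[OF t] by auto
qed

lemma ex_th_preimage: "\<exists>x::'b. th x = y"
proof -
  have "\<exists>x. poly [:1, y, 1:] x = 0"
    by (rule alg_closed_imp_poly_has_root) simp
  then obtain x where x: "poly [:1, y, 1:] x = 0" ..
  then have "x \<noteq> 0" by auto
  then have "x + inverse x + y = (x * (x + y) + 1) / x" by (simp add: field_simps)
  also have "\<dots> = 0" using x by (simp add: algebra_simps)
  finally show ?thesis by (auto simp: th_def)
qed

lemma ex_tree_point: "\<exists>t::'b. (th ^^ j) t = 1"
proof (induction j)
  case (Suc j)
  then obtain s :: 'b where "(th ^^ j) s = 1" by blast
  moreover obtain t where "th t = s" using ex_th_preimage by blast
  ultimately have "(th ^^ Suc j) t = 1" by (simp add: funpow_swap1)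
  then show ?case ..
qed auto

lemma th_iter_eq_cases:
  assumes "(w::'b) \<in> free_points m" "w' \<in> free_points m" "(th ^^ Suc j) w = (th ^^ Suc j) w'"
  shows "(th ^^ j) w = (th ^^ j) w' \<or> (th ^^ j) w * (th ^^ j) w' = 1"
  using assms th_eq_iff[of "(th ^^ j) w" "(th ^^ j) w'"] by (auto simp: free_points_def)

section \<open>Depth of the backward trees\<close>

text \<open>
Two points with the same image under \<open>th ^^ j\<close> differ by a point of the tree above 1 at a level
below \<open>multiplicity 2 m\<close>, or by the point of order two. The former have as trace an even multiple
of 1, so translating by them does not change the trace; translation by the latter exchanges \<open>x\<close> and \<open>inverse x\<close>,
whose traces agree.
\<close>

lemma tr_eq_of_th_iter_eq:
  assumes "m > 0" "(w::'b) \<in> free_points m" "w' \<in> free_points m"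
    and "(th ^^ j) w = (th ^^ j) w'" "j \<le> Suc (multiplicity 2 m)"
  shows "tr m w = tr m w'"
  using assms(2-)
proof (induction j arbitrary: w w')
  case (Suc j)
  show ?case
  proof (cases "(th ^^ j) w = (th ^^ j) w'")
    case True
    then show ?thesis using Suc.IH[OF Suc.prems(1,2)] Suc.prems(4) by simp
  next
    case False
    then have inv: "(th ^^ j) w * (th ^^ j) w' = 1" using th_iter_eq_cases Suc.prems by blast
    show ?thesis
    proof (cases j)
      case 0
      then have "w' = inverse w" using inv by (simp add: inverse_unique)
      then show ?thesis using Suc.prems(1) by (simp add: free_points_def)
    next
      case (Suc i)
      obtain t :: 'b where t: "(th ^^ i) t = 1" using ex_tree_point by blast
      have "2 ^ Suc i dvd m"
        using Suc Suc.prems(4) by (intro multiplicity_dvd') simp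
      then obtain c where "m = 2 ^ i * (2 * c)"
        by (auto simp: mult_ac)
      then have "2 ^ i dvd m" "even (m div 2 ^ i)"
        by simp_all
      with translate[OF Suc.prems(1) t] obtain v where v: "v \<in> free_points m" "tr m v = tr m w"
          "(th ^^ j) v * (th ^^ j) w = 1"
        by (auto simp: Suc of_nat_parity)
      have "(th ^^ j) v = (th ^^ j) w'"
        using v(3) inv by (metis inverse_unique mult.commute)
      then show ?thesis using Suc.IH[OF v(1) Suc.prems(2)] v(2) Suc.prems(4) by simp
    qed
  qed
qed simp

text \<open>
Two distinct nonzero elements with the same image under \<open>th\<close> are inverse to each other. If both were in the
image of \<open>th ^^ (e + 2)\<close>, where \<open>e = multiplicity 2 m\<close>, they would be images under \<open>th ^^ Suc e\<close> of elements \<open>w\<close>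
and \<open>w'\<close> of trace 0. But translation by a point at level \<open>e\<close>, which has trace 1, carries \<open>w\<close> to
an element of trace 1 with the same image as \<open>w'\<close>.
\<close>

lemma th_inj_on_deep_points:
  assumes "m > 0"
  shows "inj_on th ((th ^^ (multiplicity 2 m + 2)) ` free_points m :: 'b set)"
proof (rule inj_onI, clarify)
  let ?e = "multiplicity 2 m"
  fix w0 w0' :: 'b
  assume w0: "w0 \<in> free_points m" "w0' \<in> free_points m"
    and eq: "th ((th ^^ (?e + 2)) w0) = th ((th ^^ (?e + 2)) w0')"
  define w w' where "w = th w0" and "w' = th w0'"
  have w: "w \<in> free_points m" "w' \<in> free_points m" "tr m w = 0" "tr m w' = 0"
    using w0 free_points_th by (auto simp: w_def w'_def)
  have it: "(th ^^ (?e + 2)) w0 = (th ^^ Suc ?e) w" "(th ^^ (?e + 2)) w0' = (th ^^ Suc ?e) w'"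
    by (simp_all add: w_def w'_def funpow_swap1)
  have "(th ^^ Suc ?e) w = (th ^^ Suc ?e) w'"
  proof (rule ccontr)
    assume "(th ^^ Suc ?e) w \<noteq> (th ^^ Suc ?e) w'"
    then have inv: "(th ^^ Suc ?e) w * (th ^^ Suc ?e) w' = 1"
      using th_iter_eq_cases[OF w(1,2), of "Suc ?e"] eq it by simp
    obtain t :: 'b where t: "(th ^^ ?e) t = 1" using ex_tree_point by blast
    obtain v where v: "v \<in> free_points m" "tr m v = 1" "(th ^^ Suc ?e) v * (th ^^ Suc ?e) w = 1"
      using translate[OF w(1) t multiplicity_dvd] w(3) odd_div_max_power[OF assms]
      by (auto simp: of_nat_parity)
    have "(th ^^ Suc ?e) v = (th ^^ Suc ?e) w'"
      using v(3) inv by (metis inverse_unique mult.commute)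
    then have "tr m v = tr m w'" using tr_eq_of_th_iter_eq[OF assms v(1) w(2)] by blast
    then show False using v w by simp
  qed
  then show "(th ^^ (?e + 2)) w0 = (th ^^ (?e + 2)) w0'" using it by simp
qed

text \<open>
Periodicity is understood for \<open>th\<close>, so it includes the case that the iterate is the fixed point 0; this is
what happens in the tree above 1, by \<open>tree_depth\<close>.
\<close>

lemma th_iter_periodic:
  assumes "m > 0" "(x::'b) \<in> subfield2 m" "tr m x = tr m (inverse x)"
  shows "\<exists>i>0. (th ^^ i) ((th ^^ (multiplicity 2 m + 2)) x) = (th ^^ (multiplicity 2 m + 2)) x"
proof (cases "x \<in> free_points m")
  case True
  let ?N = "(th ^^ (multiplicity 2 m + 2)) ` free_points m :: 'b set"
  have "finite ?N"
    using finite_subfield2[OF assms(1)] by (auto simp: free_points_def)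
  moreover have "th ` ?N \<subseteq> ?N"
  proof clarify
    fix y :: 'b assume "y \<in> free_points m"
    then have "th y \<in> free_points m" by (rule free_points_th)
    then show "th ((th ^^ (multiplicity 2 m + 2)) y) \<in> ?N"
      by (metis funpow_swap1 image_eqI)
  qed
  ultimately show ?thesis
    using th_inj_on_deep_points[OF assms(1)] True by (intro inj_self_map_periodic) auto
next
  case False
  then have ex: "\<exists>j. (th ^^ j) x = 0" using assms by (auto simp: free_points_def)
  define j where "j = (LEAST j. (th ^^ j) x = 0)"
  have j: "(th ^^ j) x = 0" unfolding j_def using ex by (rule LeastI_ex)
  have "j \<le> multiplicity 2 m + 2"
  proof (cases "j > 0")
    case True
    then obtain k where k: "j = Suc k" using gr0_implies_Suc by blast
    then have "k < j" by simp
    then have "(th ^^ k) x \<noteq> 0" unfolding j_def by (rule not_less_Least)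
    then have "(th ^^ k) x = 1" using j k by (simp add: th_eq_0_iff)
    then show ?thesis using tree_depth[OF assms(1,2) \<open>(th ^^ k) x = 1\<close>] k by simp
  qed simp
  then have "(th ^^ (multiplicity 2 m + 2 - j + j)) x = 0"
    unfolding th_iter_add j by simp
  then have "(th ^^ (multiplicity 2 m + 2)) x = 0"
    using \<open>j \<le> _\<close> by simp
  then show ?thesis by (intro exI[of _ 1]) simp
qed

section \<open>Degrees along a backward orbit\<close>

text \<open>
In the application \<open>root i x\<close> says that \<open>g * x\<close> is a root of \<open>f i\<close>, and \<open>D i\<close> is the degree of \<open>f i\<close>. The
time \<open>t\<close> is the last one at which the orbit lies in the quadratic extension \<open>subfield2 M\<close> of
\<open>subfield2 (s * n)\<close>. The orbit then is not in \<open>subfield2 (s * n)\<close> any more, since the preimages under \<open>th\<close>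
of an element of that field are in the extension. The first time outside \<open>subfield2 (s * n)\<close> would
not do for \<open>t\<close>: the degree may stay equal to \<open>2 * n\<close> for several steps.
\<close>

lemma backward_orbit_doubling:
  fixes root :: "nat \<Rightarrow> 'b \<Rightarrow> bool" and D :: "nat \<Rightarrow> nat" and s n :: nat
  assumes pos: "s > 0" "n > 0" and D0: "D 0 = n"
    and ex: "\<And>i. \<exists>x. root i x"
    and down: "\<And>i x. root (Suc i) x \<Longrightarrow> root i (th x)"
    and deg: "\<And>i x k. root i x \<Longrightarrow> x \<in> subfield2 (s * k) \<longleftrightarrow> D i dvd k"
    and tr: "\<And>i x y k. root i x \<Longrightarrow> root i y \<Longrightarrow> tr (s * k) x = 0 \<Longrightarrow> tr (s * k) y = 0"
    and np: "\<And>x j. root 1 x \<Longrightarrow> j > 0 \<Longrightarrow> (th ^^ j) x \<noteq> x"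
  shows "\<exists>t. 0 < t \<and> t \<le> multiplicity 2 s + multiplicity 2 n + 3
           \<and> D t = 2 * n \<and> (\<forall>i\<ge>t. D (Suc i) = 2 * D i)"
proof -
  define M where "M = s * (2 * n)"
  have M: "M > 0" using pos by (simp add: M_def)
  have e: "multiplicity 2 M = multiplicity 2 s + multiplicity 2 n + 1"
    using pos by (simp add: M_def prime_elem_multiplicity_mult_distrib)
  \<comment> \<open>the orbit starts with both traces 0, and \<open>tr M x + tr M (inverse x) = tr M (th x)\<close> vanishes
    if the traces of \<open>th x\<close> and of its inverse agree, as the latter is 0\<close>
  have curve: "tr M x = tr M (inverse x)" if "root i x" "x \<in> subfield2 M" for i x
    using that
  proof (induction i arbitrary: x)
    case 0
    then have "x \<in> subfield2 (s * n)" using deg[of 0 x n] D0 by simp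
    moreover have "M = s * n * 2" by (simp add: M_def)
    ultimately show ?case by (simp only: tr_multiple subfield2_inverse) simp
  next
    case (Suc i)
    then have "tr M (th x) = tr M (inverse (th x))" using down subfield2_th by blast
    also have "\<dots> = 0" using Suc.prems tr_inverse_th by blast
    finally show ?case by (simp add: th_def tr_add)
  qed
  have downs: "root i ((th ^^ k) x)" if "root (i + k) x" for i k x
    using that by (induction k arbitrary: i) (auto intro: down simp flip: add_Suc)
  \<comment> \<open>otherwise \<open>multiplicity 2 M + 2\<close> iterations of \<open>th\<close> would lead from \<open>x\<close> to a periodic element at a positive
    time, and further ones to a periodic element at time 1\<close>
  have bound: "i \<le> multiplicity 2 M + 2" if "D i dvd 2 * n" for i
  proof (rule ccontr)
    assume "\<not> ?thesis"
    then have i: "i = (1 + (i - multiplicity 2 M - 3)) + (multiplicity 2 M + 2)" by simp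
    obtain x where x: "root i x" using ex by blast
    then have xM: "x \<in> subfield2 M" using that deg by (simp add: M_def)
    define y where "y = (th ^^ (multiplicity 2 M + 2)) x"
    define z where "z = (th ^^ (i - multiplicity 2 M - 3)) y"
    obtain p where p: "p > 0" "(th ^^ p) y = y"
      using th_iter_periodic[OF M xM curve[OF x xM]] by (auto simp: y_def)
    have "(th ^^ p) z = z"
      unfolding z_def by (metis p(2) add.commute th_iter_add)
    moreover have "root 1 z"
      unfolding z_def y_def using x i by (intro downs) metis
    ultimately show False using np p by blast
  qed
  have "D 1 dvd 2 * n"
  proof -
    obtain x where x: "root 1 x" using ex by blast
    then have "th x \<in> subfield2 (s * n)" using down[of 0 x] deg[of 0 "th x" n] D0 by simp
    then have "x \<in> subfield2 (s * (2 * n))"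
      using th_preimage_quadratic[of x "s * n"] by (simp add: mult.left_commute)
    then show ?thesis using deg[OF x] by blast
  qed
  define I where "I = {i. D i dvd 2 * n}"
  define t where "t = Max I"
  have "1 \<in> I" using \<open>D 1 dvd 2 * n\<close> by (simp add: I_def)
  have "I \<subseteq> {..multiplicity 2 M + 2}" using bound unfolding I_def by blast
  then have fin: "finite I" by (rule finite_subset) simp
  have "t \<in> I" unfolding t_def using fin \<open>1 \<in> I\<close> by (intro Max_in) blast+
  then have Dt: "D t dvd 2 * n" by (simp add: I_def)
  have t1: "t \<ge> 1" unfolding t_def using fin \<open>1 \<in> I\<close> by (rule Max_ge)
  have Dt': "\<not> D (Suc t) dvd 2 * n"
  proof
    assume "D (Suc t) dvd 2 * n"
    then have "Suc t \<in> I" by (simp add: I_def)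
    with fin have "Suc t \<le> t" unfolding t_def by (rule Max_ge)
    then show False by simp
  qed
  have Ddvd: "D i dvd D (Suc i)" for i
  proof -
    obtain x where x: "root (Suc i) x" using ex by blast
    then have "x \<in> subfield2 (s * D (Suc i))" using deg by simp
    then have "th x \<in> subfield2 (s * D (Suc i))" by (rule subfield2_th)
    then show ?thesis using deg[OF down[OF x]] by simp
  qed
  have "D 0 dvd D i" for i
    by (induction i) (simp, rule dvd_trans[OF _ Ddvd])
  from this[of t] have "n dvd D t" using D0 by simp
  obtain z where z: "root (Suc t) z" using ex by blast
  have zM: "z \<notin> subfield2 M" using deg[OF z, of "2 * n"] Dt' by (simp add: M_def)
  have D2: "D t = 2 * n"
  proof (rule eq_double_of_dvd[OF \<open>n dvd D t\<close> Dt])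
    show "\<not> D t dvd n"
    proof
      assume "D t dvd n"
      then have "th z \<in> subfield2 (s * n)" using deg[OF down[OF z]] by blast
      then have "z \<in> subfield2 (s * (2 * n))"
        using th_preimage_quadratic[of z "s * n"] by (simp add: mult.left_commute)
      then show False using zM by (simp add: M_def)
    qed
  qed
  \<comment> \<open>the state that reproduces itself by \<open>th_preimage_doubles\<close>\<close>
  define P where "P i \<longleftrightarrow> (\<forall>x. root i x \<longrightarrow> tr (s * D i) x = 1 \<and> tr (s * D i) (inverse x) = 1)" for i
  have sDt: "s * D t = M" by (simp add: D2 M_def)
  have mem: "x \<in> subfield2 M" if "root t x" for x
    using deg[OF that, of "D t"] sDt by simp
  have "P t"
    unfolding P_def sDt
  proof (intro allI impI)
    fix x assume x: "root t x"
    have "tr M (inverse (th z)) \<noteq> 0"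
      using th_preimage_in_subfield[of z M] mem[OF down[OF z]] zM by blast
    then have "tr M (th z) \<noteq> 0" using curve[OF down[OF z] mem[OF down[OF z]]] by metis
    then have "tr M x \<noteq> 0"
      using tr[OF x down[OF z], of "D t"] unfolding sDt by blast
    then have "tr M x = 1" using tr_0_or_1[OF mem[OF x]] by blast
    then show "tr M x = 1 \<and> tr M (inverse x) = 1" using curve[OF x mem[OF x]] by metis
  qed
  have doubling: "D (Suc i) = 2 * D i \<and> P (Suc i)" if "P i" for i
  proof -
    have *: "x \<notin> subfield2 (s * D i)" "x \<in> subfield2 (s * (2 * D i))"
        "tr (s * (2 * D i)) x = 1" "tr (s * (2 * D i)) (inverse x) = 1" if x: "root (Suc i) x" for x
    proof -
      have "th x \<in> subfield2 (s * D i)" using deg[OF down[OF x], of "D i"] by simp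
      moreover have "tr (s * D i) (th x) = 1" "tr (s * D i) (inverse (th x)) = 1"
        using \<open>P i\<close> down[OF x] unfolding P_def by blast+
      ultimately have "x \<notin> subfield2 (s * D i)" "x \<in> subfield2 (2 * (s * D i))"
        "tr (2 * (s * D i)) x = 1" "tr (2 * (s * D i)) (inverse x) = 1"
        by (fact th_preimage_doubles)+
      then show "x \<notin> subfield2 (s * D i)" "x \<in> subfield2 (s * (2 * D i))"
        "tr (s * (2 * D i)) x = 1" "tr (s * (2 * D i)) (inverse x) = 1"
        unfolding mult.left_commute[of s 2] by blast+
    qed
    obtain x where x: "root (Suc i) x" using ex by blast
    have D: "D (Suc i) = 2 * D i"
      using *(1,2)[OF x] deg[OF x, of "D i"] deg[OF x, of "2 * D i"]
      by (intro eq_double_of_dvd[OF Ddvd]) simp_all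
    then show ?thesis unfolding P_def D using *(3,4) by blast
  qed
  have "P i" if "i \<ge> t" for i
    using that
  proof (induction i rule: dec_induct)
    case base
    show ?case by (fact \<open>P t\<close>)
  next
    case (step i)
    then show ?case using doubling[of i] by simp
  qed
  then have "D (Suc i) = 2 * D i" if "i \<ge> t" for i
    using doubling[of i] that by simp
  moreover have "t \<le> multiplicity 2 s + multiplicity 2 n + 3"
    using bound[OF Dt] e by simp
  ultimately show ?thesis using t1 D2 by (intro exI[of _ t]) simp
qed

end

section \<open>Finite fields inside their algebraic closure\<close>

text \<open>
Evaluation at a fixed element of the closure is a ring homomorphism; the simplification rules say so.
\<close>

definition ac_poly :: "'a::field poly \<Rightarrow> 'a alg_closure \<Rightarrow> 'a alg_closure" where
  "ac_poly p b = poly (map_poly to_ac p) b"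

lemma ac_poly_pCons [simp]: "ac_poly (pCons a p) b = to_ac a + b * ac_poly p b"
  by (simp add: ac_poly_def map_poly_pCons)

lemma ac_poly_0 [simp]: "ac_poly 0 b = 0"
  by (simp add: ac_poly_def)

lemma ac_poly_1 [simp]: "ac_poly 1 b = 1"
  by (simp add: ac_poly_def)

lemma ac_poly_add [simp]: "ac_poly (p + q) b = ac_poly p b + ac_poly q b"
  by (induction p q rule: poly_induct2) (simp_all add: algebra_simps)

lemma ac_poly_smult [simp]: "ac_poly (Polynomial.smult c p) b = to_ac c * ac_poly p b"
  by (induction p) (simp_all add: algebra_simps)

lemma ac_poly_mult [simp]: "ac_poly (p * q) b = ac_poly p b * ac_poly q b"
  by (induction p) (simp_all add: algebra_simps)

lemma ac_poly_diff [simp]: "ac_poly (p - q) b = ac_poly p b - ac_poly q b"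
  by (metis ac_poly_add add_diff_cancel_right' diff_add_cancel)

lemma ac_poly_power [simp]: "ac_poly (p ^ k) b = ac_poly p b ^ k"
  by (induction k) simp_all

lemma ac_poly_sum [simp]: "ac_poly (\<Sum>i\<in>I. p i) b = (\<Sum>i\<in>I. ac_poly (p i) b)"
  by (induction I rule: infinite_finite_induct) simp_all

lemma ac_poly_altdef:
  "ac_poly p b = (\<Sum>i\<le>Polynomial.degree p. to_ac (Polynomial.coeff p i) * b ^ i)"
  by (simp add: ac_poly_def poly_altdef degree_map_poly coeff_map_poly)

lemma ac_poly_monom [simp]: "ac_poly (Polynomial.monom c k) b = to_ac c * b ^ k"
  by (simp add: ac_poly_def map_poly_monom poly_monom)

lemma ex_ac_root:
  assumes "Factorial_Ring.irreducible (f :: 'a::field poly)"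
  shows "\<exists>b. ac_poly f b = 0"
proof -
  have "Polynomial.degree f > 0"
    using assms by (metis Factorial_Ring.irreducible_def is_unit_iff_degree neq0_conv)
  then have "Polynomial.degree (map_poly to_ac f) > 0"
    by (simp add: degree_map_poly)
  then show ?thesis
    unfolding ac_poly_def by (rule alg_closed_imp_poly_has_root)
qed

text \<open>
A nonzero polynomial \<open>g\<close> of least degree that vanishes at \<open>b\<close> divides all others. In particular it divides
\<open>f\<close>, so irreducibility makes it an associate of \<open>f\<close>.
\<close>

lemma irreducible_dvd_iff:
  assumes f: "Factorial_Ring.irreducible (f :: 'a::field poly)" "ac_poly f b = 0"
  shows "ac_poly p b = 0 \<longleftrightarrow> f dvd p"
proof
  assume p: "ac_poly p b = 0"
  define I where "I = {g :: 'a poly. g \<noteq> 0 \<and> ac_poly g b = 0}"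
  have "f \<in> I" using f by (auto simp: I_def Factorial_Ring.irreducible_def)
  then obtain g where g: "g \<in> I" "\<And>h. h \<in> I \<Longrightarrow> Polynomial.degree g \<le> Polynomial.degree h"
    using ex_has_least_nat[of "\<lambda>g. g \<in> I" f Polynomial.degree] by blast
  have dvd: "g dvd h" if "ac_poly h b = 0" for h
  proof (rule ccontr)
    assume "\<not> g dvd h"
    then have "h mod g \<noteq> 0" by (simp add: mod_eq_0_iff_dvd)
    moreover have "ac_poly (h mod g) b = 0"
      using that g(1) by (simp add: minus_div_mult_eq_mod[symmetric] I_def)
    ultimately have "h mod g \<in> I" by (simp add: I_def)
    then show False
      using g(2)[of "h mod g"] degree_mod_less[of g h] \<open>h mod g \<noteq> 0\<close> g(1) by (auto simp: I_def)
  qed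
  obtain c where c: "f = g * c" using dvd f(2) by blast
  have "\<not> is_unit g"
  proof
    assume "is_unit g"
    then have "Polynomial.degree g = 0" using g(1) by (simp add: I_def is_unit_iff_degree)
    then obtain a where "g = [:a:]" by (rule degree_eq_zeroE)
    then show False using g(1) by (simp add: I_def)
  qed
  then have "is_unit c" using f(1) c by (auto simp: Factorial_Ring.irreducible_def)
  then have "f dvd g" using c by (simp add: mult_unit_dvd_iff)
  then show "f dvd p" using dvd[OF p] by (rule dvd_trans)
qed (use f in auto)

lemma card_degree_less:
  "card {p :: 'a::{field,finite} poly. \<forall>i\<ge>d. Polynomial.coeff p i = 0} = CARD('a) ^ d
   \<and> finite {p :: 'a poly. \<forall>i\<ge>d. Polynomial.coeff p i = 0}"
proof (induction d)
  case 0
  have "{p :: 'a poly. \<forall>i\<ge>0. Polynomial.coeff p i = 0} = {0}"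
    by (auto simp: poly_eq_iff)
  then show ?case by simp
next
  case (Suc d)
  let ?S = "\<lambda>d. {p :: 'a poly. \<forall>i\<ge>d. Polynomial.coeff p i = 0}"
  have eq: "?S (Suc d) = (\<lambda>(a, p). pCons a p) ` (UNIV \<times> ?S d)"
  proof (intro equalityI subsetI)
    fix p assume p: "p \<in> ?S (Suc d)"
    obtain a q where "p = pCons a q" by (rule pCons_cases)
    moreover from this have "Polynomial.coeff q i = 0" if "i \<ge> d" for i
      using p that by (auto dest!: spec[of _ "Suc i"])
    ultimately show "p \<in> (\<lambda>(a, p). pCons a p) ` (UNIV \<times> ?S d)" by auto
  next
    fix p assume "p \<in> (\<lambda>(a, p). pCons a p) ` (UNIV \<times> ?S d)"
    then show "p \<in> ?S (Suc d)" by (auto simp: coeff_pCons split: nat.split)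
  qed
  have "inj_on (\<lambda>(a, p). pCons a p) (UNIV \<times> ?S d)" by (auto simp: inj_on_def)
  then show ?case unfolding eq using Suc by (simp add: card_image card_cartesian_product)
qed

text \<open>
Multiplication by a nonzero \<open>x\<close> permutes the nonzero elements of \<open>V\<close>; comparing their products gives
\<open>x ^ (card V - 1) = 1\<close>. It is applied to a finite field and, in the closure, to the subring
generated over it by a root.
\<close>

lemma power_card_eq_self:
  fixes V :: "'b::field set"
  assumes "finite V" "0 \<in> V" "\<And>x y. x \<in> V \<Longrightarrow> y \<in> V \<Longrightarrow> x * y \<in> V" "x \<in> V"
  shows "x ^ card V = x"
proof (cases "x = 0")
  case True
  then show ?thesis using assms card_gt_0_iff[of V] by (auto simp: power_0_left)
next
  case False
  let ?U = "V - {0}"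
  have "inj_on ((*) x) ?U" using False by (auto simp: inj_on_def)
  moreover have "(*) x ` ?U \<subseteq> ?U" using False assms by auto
  ultimately have "(*) x ` ?U = ?U" using assms(1) by (metis endo_inj_surj finite_Diff)
  then have "(\<Prod>y\<in>?U. y) = (\<Prod>y\<in>(*) x ` ?U. y)" by simp
  also have "\<dots> = (\<Prod>y\<in>?U. x * y)"
    using \<open>inj_on ((*) x) ?U\<close> by (simp add: prod.reindex)
  also have "\<dots> = x ^ card ?U * (\<Prod>y\<in>?U. y)" by (simp add: prod.distrib)
  finally have "x ^ card ?U = 1" using assms(1) by simp
  moreover have "card V = Suc (card ?U)"
    using assms by (metis card.remove)
  ultimately show ?thesis by simp
qed

lemma finite_field_closed_char2:
  assumes "CARD('a::{field,finite}) = 2 ^ s"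
  shows "closed_field_char2 TYPE('a alg_closure)"
proof
  have "(\<Sum>x\<in>UNIV. x + 1) = (\<Sum>x\<in>UNIV. x::'a)"
    by (rule sum.reindex_bij_witness[of _ "\<lambda>x. x - 1" "\<lambda>x. x + 1"]) auto
  then have "of_nat (2 ^ s) = (0::'a)"
    by (simp add: sum.distrib assms)
  then have "CHAR('a) dvd 2 ^ s" by (simp only: of_nat_eq_0_iff_char_dvd)
  moreover have "prime CHAR('a)"
    using prime_CHAR_semidom finite_imp_CHAR_pos by (metis finite)
  ultimately have "CHAR('a) = 2"
    using prime_dvd_power primes_dvd_imp_eq two_is_prime_nat by blast
  then show "CHAR('a alg_closure) = 2" by simp
qed

text \<open>
The image is contained in the \<open>2 ^ s\<close> or fewer solutions of \<open>x ^ (2 ^ s) = x\<close>, and it has that many elements.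
\<close>

lemma range_to_ac:
  assumes "CARD('a::{field,finite}) = 2 ^ s" "s > 0"
  shows "range (to_ac :: 'a \<Rightarrow> _) = subfield2 s"
proof -
  interpret closed_field_char2 "TYPE('a alg_closure)"
    using assms by (intro finite_field_closed_char2)
  have "x ^ 2 ^ s = x" for x :: 'a
    using power_card_eq_self[of UNIV x] assms by simp
  then have "range (to_ac :: 'a \<Rightarrow> _) \<subseteq> subfield2 s"
    by (auto simp: subfield2_def simp flip: to_ac_power)
  moreover have "card (range (to_ac :: 'a \<Rightarrow> _)) = 2 ^ s"
    using assms by (simp add: card_image inj_to_ac)
  ultimately show ?thesis
    using finite_subfield2[OF assms(2)]
    by (intro card_seteq) simp_all
qed

text \<open>
Let \<open>d\<close> be the degree of \<open>f\<close>. The values at \<open>b\<close> of all polynomials form a ring \<open>V\<close> with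
\<open>2 ^ (s * d)\<close> elements, because remainders modulo \<open>f\<close> represent them uniquely. Hence
\<open>b ^ card V = b\<close>, which is membership for \<open>k = d\<close>. Conversely, a field that contains \<open>b\<close> contains
\<open>V\<close>, so counting gives \<open>d \<le> k\<close> for positive \<open>k\<close>, and division with remainder gives \<open>d dvd k\<close>.
\<close>

lemma root_in_subfield2_iff:
  fixes f :: "'a::{field,finite} poly"
  assumes q: "CARD('a) = 2 ^ s" "s > 0" and f: "Factorial_Ring.irreducible f" "ac_poly f b = 0"
  shows "b \<in> subfield2 (s * k) \<longleftrightarrow> Polynomial.degree f dvd k"
proof -
  interpret closed_field_char2 "TYPE('a alg_closure)"
    using q by (intro finite_field_closed_char2)
  define d where "d = Polynomial.degree f"
  have f0: "f \<noteq> 0" using f by auto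
  have d: "d > 0"
    using f by (metis d_def Factorial_Ring.irreducible_def is_unit_iff_degree neq0_conv)
  let ?S = "{p :: 'a poly. \<forall>i\<ge>d. Polynomial.coeff p i = 0}"
  define V where "V = range (\<lambda>p. ac_poly p b)"
  have V: "V = (\<lambda>p. ac_poly p b) ` ?S"
  proof -
    have "ac_poly p b \<in> (\<lambda>p. ac_poly p b) ` ?S" for p
    proof (rule image_eqI)
      show "ac_poly p b = ac_poly (p mod f) b"
        using f(2) by (simp add: minus_div_mult_eq_mod[symmetric] del: diff_eq)
      show "p mod f \<in> ?S"
        using degree_mod_less[OF f0, of p] by (auto simp: d_def coeff_eq_0)
    qed
    then show ?thesis by (auto simp: V_def)
  qed
  have "inj_on (\<lambda>p. ac_poly p b) ?S"
  proof (rule inj_onI)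
    fix p p' assume p: "p \<in> ?S" "p' \<in> ?S" "ac_poly p b = ac_poly p' b"
    then have "f dvd p - p'"
      using irreducible_dvd_iff[OF f, of "p - p'"] by simp
    moreover have "p - p' = 0 \<or> Polynomial.degree (p - p') < d"
    proof -
      have "Polynomial.coeff (p - p') i = 0" if "i \<ge> d" for i
        using that p by simp
      then show ?thesis by (metis leading_coeff_0_iff not_le)
    qed
    ultimately have "p - p' = 0"
      using dvd_imp_degree_le[of f "p - p'"] unfolding d_def by linarith
    then show "p = p'" by simp
  qed
  then have card: "card V = 2 ^ (s * d)"
    unfolding V using card_degree_less[where ?'a='a, of d] q by (simp add: card_image power_mult)
  have fin: "finite V"
    unfolding V using card_degree_less[where ?'a='a, of d] by simp
  have b: "b = ac_poly [:0, 1:] b" by simp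
  have "b ^ card V = b"
  proof (rule power_card_eq_self[OF fin])
    show "0 \<in> V" unfolding V_def by (rule range_eqI[of _ _ 0]) simp
    show "b \<in> V" unfolding V_def using b by (intro image_eqI[of _ _ "[:0, 1:]"]) simp_all
    show "x * y \<in> V" if xy: "x \<in> V" "y \<in> V" for x y
    proof -
      obtain p p' where "x = ac_poly p b" "y = ac_poly p' b"
        using xy by (auto simp: V_def)
      then have "x * y = ac_poly (p * p') b" by simp
      then show ?thesis unfolding V_def by (rule image_eqI) simp
    qed
  qed
  then have bd: "b \<in> subfield2 (s * d)" by (simp add: card subfield2_def)
  have min: "d \<le> k" if "k > 0" "b \<in> subfield2 (s * k)" for k
  proof -
    have "ac_poly p b \<in> subfield2 (s * k)" for p
    proof (induction p)
      case (pCons a p)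
      have "to_ac a \<in> subfield2 s" using range_to_ac[OF q] by blast
      then show ?case
        using pCons that by (simp add: subfield2_add subfield2_mult subfield2_multiple)
    qed simp
    then have "V \<subseteq> subfield2 (s * k)" by (auto simp: V_def)
    then have "card V \<le> card (subfield2 (s * k) :: 'a alg_closure set)"
      using that q by (intro card_mono finite_subfield2(1)) auto
    also have "\<dots> \<le> 2 ^ (s * k)" using that q by (intro finite_subfield2(2)) auto
    finally show ?thesis using q by (simp add: card)
  qed
  show ?thesis
  proof
    assume "Polynomial.degree f dvd k"
    then obtain c where "k = d * c" by (auto simp: d_def)
    then show "b \<in> subfield2 (s * k)"
      using subfield2_multiple[OF bd, of c] by (simp add: mult.assoc)
  next
    assume bk: "b \<in> subfield2 (s * k)"
    have "s * k = s * d * (k div d) + s * (k mod d)"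
      by (metis mult_div_mod_eq distrib_left mult.assoc)
    then have "b ^ 2 ^ (s * k) = (b ^ 2 ^ (s * d * (k div d))) ^ 2 ^ (s * (k mod d))"
      by (simp only: power_add power_mult)
    also have "\<dots> = b ^ 2 ^ (s * (k mod d))" using pow_iter[OF bd] by simp
    finally have "b \<in> subfield2 (s * (k mod d))" using bk by (simp add: subfield2_def)
    then have "k mod d = 0" using min[of "k mod d"] d by (metis gr0I mod_less_divisor not_le)
    then show "Polynomial.degree f dvd k" by (auto simp: d_def)
  qed
qed

section \<open>The transform and its roots\<close>

lemma Q_transform_root:
  fixes f :: "'a::field poly"
  assumes "f \<noteq> 0" "a \<noteq> 0" "ac_poly (Q_transform a f) b = 0"
  shows "b \<noteq> 0" "ac_poly f (b + to_ac a * inverse b) = 0"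
proof -
  let ?d = "Polynomial.degree f"
  have Q: "ac_poly (Q_transform a f) b = (\<Sum>i\<le>?d. to_ac (Polynomial.coeff f i) *
      ((to_ac a + b * b) ^ i * b ^ (?d - i)))"
    by (simp add: Q_transform_def)
  show b: "b \<noteq> 0"
  proof
    assume "b = 0"
    then have "0 = (\<Sum>i\<le>?d. to_ac (Polynomial.coeff f i) * (to_ac a ^ i * 0 ^ (?d - i)))"
      using assms(3) unfolding Q by simp
    also have "\<dots> = (\<Sum>i\<in>{?d}. to_ac (Polynomial.coeff f i) * (to_ac a ^ i * 0 ^ (?d - i)))"
      by (rule sum.mono_neutral_right) (auto simp: power_0_left)
    finally show False using assms(1,2) by simp
  qed
  have "ac_poly (Q_transform a f) b = b ^ ?d * ac_poly f (b + to_ac a * inverse b)"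
    unfolding Q ac_poly_altdef[of f] sum_distrib_left
  proof (rule sum.cong)
    fix i assume "i \<in> {..?d}"
    then have d: "b ^ ?d = b ^ i * b ^ (?d - i)" by (simp flip: power_add)
    have "to_ac a + b * b = b * (b + to_ac a * inverse b)"
      using b by (simp add: distrib_left mult.left_commute)
    then show "to_ac (Polynomial.coeff f i) * ((to_ac a + b * b) ^ i * b ^ (?d - i)) =
        b ^ ?d * (to_ac (Polynomial.coeff f i) * (b + to_ac a * inverse b) ^ i)"
      by (simp only: d power_mult_distrib ac_simps)
  qed simp
  then show "ac_poly f (b + to_ac a * inverse b) = 0" using assms(3) b by simp
qed

lemma degree_Q_transform_le: "Polynomial.degree (Q_transform a f) \<le> 2 * Polynomial.degree f"
proof -
  have "Polynomial.degree (Polynomial.smult (Polynomial.coeff f i)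
      ([:a, 0, 1:] ^ i * [:0, 1:] ^ (Polynomial.degree f - i))) \<le> 2 * Polynomial.degree f"
    if "i \<le> Polynomial.degree f" for i
  proof -
    have "Polynomial.degree ([:a, 0, 1:] ^ i * [:0, 1:] ^ (Polynomial.degree f - i))
        \<le> 2 * i + (Polynomial.degree f - i)"
      by (rule order_trans[OF degree_mult_le]) (intro add_mono order_trans[OF degree_power_le]; simp)
    also have "\<dots> \<le> 2 * Polynomial.degree f" using that by simp
    finally show ?thesis using degree_smult_le order_trans by blast
  qed
  then show ?thesis unfolding Q_transform_def by (intro degree_sum_le) auto
qed

text \<open>
This is how degree doubling yields irreducibility: the transform has at most twice the degree of \<open>f\<close>.
\<close>

lemma irreducible_of_full_degree_factor:
  fixes g h :: "'a::field poly"
  assumes "Factorial_Ring.irreducible g" "g dvd h" "h \<noteq> 0" "Polynomial.degree h \<le> Polynomial.degree g"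
  shows "Factorial_Ring.irreducible h"
proof -
  obtain c where c: "h = g * c" using assms(2) by blast
  then have "Polynomial.degree c = 0" "c \<noteq> 0"
    using assms(3,4) by (auto simp: degree_mult_eq)
  then have "is_unit c" by (simp add: is_unit_iff_degree)
  then show ?thesis using assms(1) c by (simp add: irreducible_mult_unit_left mult.commute)
qed

lemma scaled_th:
  assumes "g \<noteq> 0"
  shows "g * x + g ^ 2 * inverse (g * x) = g * th x"
proof -
  have "g ^ 2 * inverse (g * x) = g * inverse x"
    using assms by (simp add: power2_eq_square)
  then show ?thesis
    by (simp only: th_def distrib_left)
qed

lemma theta_iter_scaled:
  assumes g: "g \<noteq> 0" and x: "\<And>j. (th ^^ j) x \<noteq> 0"
  shows "(theta (g ^ 2) ^^ j) (Some (g * x)) = Some (g * (th ^^ j) x)"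
proof (induction j)
  case (Suc j)
  have "g * (th ^^ j) x \<noteq> 0"
    using g x by simp
  then have "theta (g ^ 2) (Some (g * (th ^^ j) x)) = Some (g * th ((th ^^ j) x))"
    by (simp only: theta.simps if_False scaled_th[OF g])
  with Suc show ?case
    by simp
qed simp

theorem theorem3p2:
  fixes s n :: nat
    and \<alpha> :: "'a :: {field, finite}"
    and f :: "nat \<Rightarrow> 'a poly"
  assumes "s > 0" and "n > 0"
    and "CARD('a) = 2 ^ s"
    and "\<alpha> \<noteq> 0"
    and "Factorial_Ring.irreducible (f 0)" and "lead_coeff (f 0) = 1"
    and "Polynomial.degree (f 0) = n"
    and "irreducible_monic_factor (f 1) (Q_transform \<alpha> (f 0))"
    and "roots_not_periodic \<alpha> (f 1)"
    and "\<And>i. i \<ge> 2 \<Longrightarrow> irreducible_monic_factor (f i) (Q_transform \<alpha> (f (i - 1)))"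
  shows "\<exists>t. 0 < t \<and> t \<le> multiplicity 2 s + multiplicity 2 n + 3
           \<and> Polynomial.degree (f t) = 2 * n
           \<and> Polynomial.degree (f (t + 1)) = 4 * n
           \<and> (\<forall>i\<ge>t. Factorial_Ring.irreducible (Q_transform \<alpha> (f i))
                   \<and> Polynomial.degree (f (i + 1)) = 2 * Polynomial.degree (f i))"
proof -
  note q = \<open>CARD('a) = 2 ^ s\<close> \<open>s > 0\<close>
  interpret closed_field_char2 "TYPE('a alg_closure)"
    using q(1) by (rule finite_field_closed_char2)
  \<comment> \<open>the square root of \<open>\<alpha>\<close>, by inverting the Frobenius map\<close>
  define g where "g = \<alpha> ^ 2 ^ (s - 1)"
  have "g ^ 2 = \<alpha> ^ 2 ^ s"
    using q(2) by (simp add: g_def flip: power_mult power_Suc2)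
  also have "\<dots> = \<alpha>"
    using power_card_eq_self[of UNIV \<alpha>] q(1) by simp
  finally have g2: "\<alpha> = g ^ 2" ..
  have g0: "g \<noteq> 0" using \<open>\<alpha> \<noteq> 0\<close> g2 by auto
  have irr: "Factorial_Ring.irreducible (f i)" for i
    using assms(5,8) assms(10)[of i]
    by (cases "i \<ge> 2") (auto simp: irreducible_monic_factor_def not_le less_2_cases_iff)
  then have f0: "f i \<noteq> 0" for i by (metis Factorial_Ring.irreducible_def)
  have dvd: "f (Suc i) dvd Q_transform \<alpha> (f i)" for i
    using assms(8) assms(10)[of "Suc i"]
    by (cases "i = 0") (auto simp: irreducible_monic_factor_def)
  define root where "root i x \<longleftrightarrow> ac_poly (f i) (to_ac g * x) = 0" for i x
  have down: "x \<noteq> 0 \<and> root i (th x)" if "root (Suc i) x" for i x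
  proof -
    have "ac_poly (Q_transform \<alpha> (f i)) (to_ac g * x) = 0"
      using that irreducible_dvd_iff[OF irr[of "Suc i"]] dvd[of i] unfolding root_def by blast
    from Q_transform_root[OF f0 \<open>\<alpha> \<noteq> 0\<close> this] have x: "x \<noteq> 0"
      and "ac_poly (f i) (to_ac g * x + to_ac \<alpha> * inverse (to_ac g * x)) = 0" by auto
    moreover have "to_ac g * x + to_ac \<alpha> * inverse (to_ac g * x) = to_ac g * th x"
      using scaled_th[of "to_ac g" x] g0 by (simp add: g2)
    ultimately show ?thesis by (simp add: root_def)
  qed
  have "\<exists>t. 0 < t \<and> t \<le> multiplicity 2 s + multiplicity 2 n + 3
      \<and> Polynomial.degree (f t) = 2 * n
      \<and> (\<forall>i\<ge>t. Polynomial.degree (f (Suc i)) = 2 * Polynomial.degree (f i))"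
  proof (rule backward_orbit_doubling[where root = root and D = "\<lambda>i. Polynomial.degree (f i)"])
    show "\<exists>x. root i x" for i
    proof -
      obtain b where "ac_poly (f i) b = 0" using ex_ac_root[OF irr] by blast
      then have "root i (b / to_ac g)" using g0 by (simp add: root_def)
      then show ?thesis ..
    qed
    show "root i (th x)" if "root (Suc i) x" for i x
      using down that by blast
    show "x \<in> subfield2 (s * k) \<longleftrightarrow> Polynomial.degree (f i) dvd k" if "root i x" for i x k
    proof -
      have "to_ac g \<in> subfield2 (s * k)"
        using range_to_ac[OF q] by (intro subfield2_multiple) blast
      then have "x \<in> subfield2 (s * k) \<longleftrightarrow> to_ac g * x \<in> subfield2 (s * k)"
        using subfield2_mult[of "to_ac g" "s * k" x] subfield2_divide[of "to_ac g * x" "s * k" "to_ac g"] g0 by auto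
      then show ?thesis
        using root_in_subfield2_iff[OF q irr] that by (simp add: root_def)
    qed
    show "tr (s * k) y = 0" if "root i x" "root i y" "tr (s * k) x = 0" for i x y k
    proof -
      \<comment> \<open>the trace is a polynomial function over the base field, so that it vanishes at all roots of \<open>f i\<close> or at none\<close>
      define T where "T = (\<Sum>j<s * k. Polynomial.monom (inverse g ^ 2 ^ j) (2 ^ j))"
      have T: "ac_poly T (to_ac g * z) = tr (s * k) z" for z
      proof -
        have "to_ac (inverse g ^ 2 ^ j) * (to_ac g * z) ^ 2 ^ j = z ^ 2 ^ j" for j
          using g0 by (simp add: mult.assoc[symmetric] flip: power_mult_distrib)
        then show ?thesis by (simp only: T_def tr_def ac_poly_sum ac_poly_monom)
      qed
      have "ac_poly T (to_ac g * x) = 0" using T that(3) by simp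
      then have "f i dvd T" using irreducible_dvd_iff[OF irr] that(1) unfolding root_def by blast
      then have "ac_poly T (to_ac g * y) = 0"
        using irreducible_dvd_iff[OF irr] that(2) unfolding root_def by blast
      then show ?thesis by (simp only: T)
    qed
    show "(th ^^ j) x \<noteq> x" if x: "root 1 x" and "j > 0" for x j
    proof
      assume j: "(th ^^ j) x = x"
      \<comment> \<open>an orbit that returns to \<open>x\<close> cannot be absorbed by 0, so on it \<open>th\<close> agrees with \<open>theta\<close>\<close>
      have jc: "(th ^^ (j * c)) x = x" for c
        by (induction c) (simp_all add: th_iter_add j)
      have "x \<noteq> 0" using down[of 0 x] x by simp
      have "(th ^^ i) x \<noteq> 0" for i
      proof
        assume "(th ^^ i) x = 0"
        then have "(th ^^ (j * i - i + i)) x = 0" unfolding th_iter_add by simp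
        moreover have "j * i - i + i = j * i" using \<open>j > 0\<close> by simp
        ultimately show False using jc[of i] \<open>x \<noteq> 0\<close> by simp
      qed
      then have "(theta (to_ac \<alpha>) ^^ j) (Some (to_ac g * x)) = Some (to_ac g * x)"
        using theta_iter_scaled[of "to_ac g" x j] g0 g2 j by simp
      then have "theta_periodic (to_ac \<alpha>) (Some (to_ac g * x))"
        unfolding theta_periodic_def using \<open>j > 0\<close> by blast
      then show False
        using assms(9) x unfolding roots_not_periodic_def root_def ac_poly_def by blast
    qed
  qed (fact assms(1,2,7))+
  then obtain t where t: "0 < t" "t \<le> multiplicity 2 s + multiplicity 2 n + 3"
    "Polynomial.degree (f t) = 2 * n"
    "\<And>i. i \<ge> t \<Longrightarrow> Polynomial.degree (f (Suc i)) = 2 * Polynomial.degree (f i)" by blast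
  have "Factorial_Ring.irreducible (Q_transform \<alpha> (f i))" if "i \<ge> t" for i
  proof (rule irreducible_of_full_degree_factor[OF irr dvd])
    show "Q_transform \<alpha> (f i) \<noteq> 0"
      using Q_transform_root(1)[OF f0 \<open>\<alpha> \<noteq> 0\<close>, of i 0] by auto
    show "Polynomial.degree (Q_transform \<alpha> (f i)) \<le> Polynomial.degree (f (Suc i))"
      using degree_Q_transform_le[of \<alpha> "f i"] t(4)[OF that] by simp
  qed
  then show ?thesis using t by (intro exI[of _ t]) simp
qed

end
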